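(* Let $k\ge 2$ be an integer. For every graph $G$ with twin-width at most $k$, we have $\gamma(G)\le 4k^2\cdot\rho(G)$.
   Context: All graphs are finite and simple. For a vertex $v$ of a graph $G$, $N_G[v]$ denotes the closed neighborhood of $v$. A dominating set of $G$ is a set of vertices whose closed neighborhoods together cover $V(G)$; $\gamma(G)$ denotes the minimum size of a dominating set. A packing in $G$ is a set of vertices whose closed neighborhoods are pairwise disjoint (equivalently, pairwise at distance at least $3$); $\rho(G)$ denotes the maximum size of a packing. Twin-width: Let $G$ be a graph and $R\subseteq E(G)$ a subset of its edges, called red edges; the edges in $E(G)\setminus R$ are called black. Contracting a pair $u,v$ of (distinct, not necessarily adjacent) vertices of $G$ results in the graph obtained from $G$ by deleting $u$ and $v$ and adding a new vertex $w$ that has a black edge to every vertex that had a black edge to both $u$ and $v$, and a red edge to every other vertex of $(N_G(u)\cup N_G(v))\setminus\{u,v\}$; all other edges keep their color. A graph $G$ with only black edges has twin-width at most $k$ if and only if there is a series of contractions from $G$ to the one-vertex graph $K_1$ such that, at every step, the red edges form a graph of maximum degree at most $k$. *)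

theory Defs
  imports "Graph_Theory.Pair_Digraph"
begin

text \<open>A finite simple graph is a \<^locale>\<open>pair_graph\<close>: a finite loopless digraph whose arcs
  are vertex pairs, with symmetric arc set. An edge \<open>uv\<close> is the two arcs \<open>(u, v)\<close>, \<open>(v, u)\<close>.\<close>

definition open_nbhd :: "'a pair_pre_digraph \<Rightarrow> 'a \<Rightarrow> 'a set" where
  "open_nbhd G v = {u. (v, u) \<in> parcs G}"

definition closed_nbhd :: "'a pair_pre_digraph \<Rightarrow> 'a \<Rightarrow> 'a set" where
  "closed_nbhd G v = insert v (open_nbhd G v)"

definition dominating_set :: "'a pair_pre_digraph \<Rightarrow> 'a set \<Rightarrow> bool" where
  "dominating_set G D \<longleftrightarrow> D \<subseteq> pverts G \<and> pverts G \<subseteq> (\<Union>v\<in>D. closed_nbhd G v)"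

definition domination_number :: "'a pair_pre_digraph \<Rightarrow> nat" where
  "domination_number G = Min (card ` {D. dominating_set G D})"

definition packing :: "'a pair_pre_digraph \<Rightarrow> 'a set \<Rightarrow> bool" where
  "packing G P \<longleftrightarrow> P \<subseteq> pverts G \<and> disjoint_family_on (closed_nbhd G) P"

definition packing_number :: "'a pair_pre_digraph \<Rightarrow> nat" where
  "packing_number G = Max (card ` {P. packing G P})"

text \<open>A graph with coloured edges is a pair \<open>(G, R)\<close>, where the set \<open>R \<subseteq> parcs G\<close> of red arcs is
  symmetric; the arcs in \<open>parcs G - R\<close> are black. In \<open>contraction u v w\<close>, the name \<open>w\<close> of the vertex
  replacing \<open>u\<close> and \<open>v\<close> is constrained in \<open>contraction_step\<close> below.\<close>

type_synonym 'a coloured_graph = "'a pair_pre_digraph \<times> 'a rel"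

definition merged_nbhd :: "'a \<Rightarrow> 'a \<Rightarrow> 'a pair_pre_digraph \<Rightarrow> 'a set" where
  "merged_nbhd u v G = (open_nbhd G u \<union> open_nbhd G v) - {u, v}"

definition black_merged_nbhd :: "'a \<Rightarrow> 'a \<Rightarrow> 'a coloured_graph \<Rightarrow> 'a set" where
  "black_merged_nbhd u v = (\<lambda>(G, R).
     {x. (u, x) \<in> parcs G - R \<and> (v, x) \<in> parcs G - R})"

definition contraction :: "'a \<Rightarrow> 'a \<Rightarrow> 'a \<Rightarrow> 'a coloured_graph \<Rightarrow> 'a coloured_graph" where
  "contraction u v w = (\<lambda>(G, R).
     let K = pverts G - {u, v};
         N = merged_nbhd u v G;
         N_red = N - black_merged_nbhd u v (G, R)
     in (\<lparr>pverts = insert w K, parcs = parcs G \<inter> K \<times> K \<union> {w} \<times> N \<union> N \<times> {w}\<rparr>,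
         R \<inter> K \<times> K \<union> {w} \<times> N_red \<union> N_red \<times> {w}))"

definition red_degree_le :: "nat \<Rightarrow> 'a coloured_graph \<Rightarrow> bool" where
  "red_degree_le k = (\<lambda>(G, R). \<forall>x \<in> pverts G. card {y. (x, y) \<in> R} \<le> k)"

text \<open>The new vertex only has to differ from the remaining vertices. It may reuse the name \<open>u\<close>
  or \<open>v\<close>, so a name is available even if \<open>G\<close> exhausts its vertex type.\<close>

definition contraction_step :: "nat \<Rightarrow> 'a coloured_graph \<Rightarrow> 'a coloured_graph \<Rightarrow> bool" where
  "contraction_step k T T' \<longleftrightarrow>
     (\<exists>u v w. u \<in> pverts (fst T) \<and> v \<in> pverts (fst T) \<and> u \<noteq> v \<and>
        w \<notin> pverts (fst T) - {u, v} \<and> T' = contraction u v w T \<and> red_degree_le k T')"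

text \<open>The initial graph has no red edges, so it meets the bound on red degrees as well.\<close>

definition twin_width_le :: "'a pair_pre_digraph \<Rightarrow> nat \<Rightarrow> bool" where
  "twin_width_le G k \<longleftrightarrow>
     (\<exists>H R. (contraction_step k)\<^sup>*\<^sup>* (G, {}) (H, R) \<and> card (pverts H) = 1)"

end

theory Submission
  imports Defs
begin

text \<open>The bound follows greedily from a local fact: every nonempty set \<open>A\<close> of vertices contains some
  \<open>a\<close> such that at most \<open>4k\<^sup>2\<close> vertices dominate every \<open>c \<in> A\<close> whose closed neighbourhood meets that
  of \<open>a\<close> (\<open>exists_cheap_vertex\<close>). Put \<open>a\<close> into the packing and those vertices into the
  dominating set, delete all such \<open>c\<close> from \<open>A\<close>, and repeat (\<open>dominating_vs_packing\<close>).

  For the local fact, regard the vertices of each graph in the contraction sequence as bags of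
  vertices of \<open>G\<close>, and call a bag good if a single vertex of \<open>G\<close> dominates its members in \<open>A\<close>. All
  bags are good at the start. If they stay good until one bag is left, one vertex dominates all of
  \<open>A\<close>. Otherwise consider the first contraction that produces a bad bag. The bad bag is the new bag
  \<open>w\<close>, since the others were good before; and \<open>w\<close> has no black neighbour, since any member of a
  black neighbour dominates all of \<open>w\<close>. Let \<open>a \<in> A\<close> be a member of \<open>w\<close>. A path of length at most 2
  in \<open>G\<close> from \<open>a\<close> to some \<open>c \<in> A\<close> can leave \<open>w\<close> only along a red edge. So \<open>c\<close> lies either in \<open>w\<close>,
  whose members in \<open>A\<close> two vertices dominate, as \<open>w\<close> is the union of two good bags; or in a bag at
  red distance 1 or 2 from \<open>w\<close>, and there are at most \<open>k + k\<^sup>2\<close> of these, all good; or in a black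
  neighbour of one of the at most \<open>k\<close> red neighbours of \<open>w\<close>, and then any fixed member of that red
  neighbour dominates \<open>c\<close>. Altogether \<open>k\<^sup>2 + 2k + 2 \<le> 4k\<^sup>2\<close>
  vertices suffice (\<open>bad_bag_cheap\<close>).\<close>

section \<open>Bags of a contraction sequence\<close>

text \<open>The map \<open>f\<close> sends each vertex of \<open>G\<close> to the bag of \<open>(H, R)\<close> that contains it. Every bag is
  nonempty, edges of \<open>G\<close> lie inside bags or between adjacent bags, and black edges of \<open>H\<close> stand for
  complete adjacency. A bag is named by a vertex of \<open>H\<close>, which need not belong to it; the values
  of \<open>f\<close> outside \<open>pverts G\<close> are irrelevant. Symmetry of \<open>parcs H\<close> and \<open>R\<close> is not required, since
  that of \<open>parcs G\<close> suffices.\<close>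

definition bag_map :: "'a pair_pre_digraph \<Rightarrow> ('a \<Rightarrow> 'a) \<Rightarrow> 'a coloured_graph \<Rightarrow> bool" where
  "bag_map G f = (\<lambda>(H, R).
     f ` pverts G = pverts H \<and> R \<subseteq> pverts H \<times> pverts H \<and> parcs H \<subseteq> pverts H \<times> pverts H \<and>
     (\<forall>x y. (x, y) \<in> parcs G \<longrightarrow> f x = f y \<or> (f x, f y) \<in> parcs H) \<and>
     (\<forall>x \<in> pverts G. \<forall>y \<in> pverts G. (f x, f y) \<in> parcs H - R \<longrightarrow> (x, y) \<in> parcs G))"

lemma bag_map_id:
  assumes "pair_graph G"
  shows "bag_map G id (G, {})"
proof -
  interpret pair_graph G by fact
  show ?thesis
    unfolding bag_map_def using in_arcsD1 in_arcsD2 by auto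
qed

lemma bag_map_contraction:
  assumes G: "pair_graph G"
    and f: "bag_map G f (H, R)"
    and u: "u \<in> pverts H" and v: "v \<in> pverts H" and w: "w \<notin> pverts H - {u, v}"
  defines "f' \<equiv> \<lambda>x. if f x \<in> {u, v} then w else f x"
  shows "bag_map G f' (contraction u v w (H, R))"
proof -
  interpret pair_graph G by fact
  note sym = arcs_symmetric
  define K where "K = pverts H - {u, v}"
  define N where "N = merged_nbhd u v H"
  define Nr where "Nr = N - black_merged_nbhd u v (H, R)"
  have C: "contraction u v w (H, R) = (\<lparr>pverts = insert w K,
      parcs = parcs H \<inter> K \<times> K \<union> {w} \<times> N \<union> N \<times> {w}\<rparr>, R \<inter> K \<times> K \<union> {w} \<times> Nr \<union> Nr \<times> {w})"
    unfolding contraction_def K_def N_def Nr_def by (simp add: Let_def)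
  have im: "f ` pverts G = pverts H" and arcsH: "parcs H \<subseteq> pverts H \<times> pverts H"
    and edge: "\<And>x y. (x, y) \<in> parcs G \<Longrightarrow> f x = f y \<or> (f x, f y) \<in> parcs H"
    and black: "\<And>x y. \<lbrakk>x \<in> pverts G; y \<in> pverts G; (f x, f y) \<in> parcs H - R\<rbrakk> \<Longrightarrow> (x, y) \<in> parcs G"
    using f unfolding bag_map_def by auto
  have NK: "N \<subseteq> K"
    using arcsH unfolding N_def K_def merged_nbhd_def open_nbhd_def by auto
  have wK: "w \<notin> K" using w unfolding K_def .
  have inK: "f x \<in> K \<longleftrightarrow> f x \<notin> {u, v}" if "x \<in> pverts G" for x
    using that im unfolding K_def by auto
  have f'K: "f' x \<in> K \<longleftrightarrow> f x \<in> K" and f'w: "f' x = w \<longleftrightarrow> f x \<notin> K" if "x \<in> pverts G" for x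
    using inK[OF that] wK unfolding f'_def K_def by auto
  have f'eq: "f' x = f x" if "f x \<in> K" for x
    using that unfolding f'_def K_def by auto
  have "f' ` pverts G = insert w K"
  proof
    show "f' ` pverts G \<subseteq> insert w K" using f'K f'w by auto
    obtain x where "x \<in> pverts G" "f x = u" using u im by (metis imageE)
    then have "w \<in> f' ` pverts G" unfolding f'_def by (intro image_eqI[of _ _ x]) auto
    moreover have "K \<subseteq> f' ` pverts G"
    proof
      fix q assume "q \<in> K"
      then obtain x where "x \<in> pverts G" "f x = q"
        using im unfolding K_def by (metis DiffD1 imageE)
      then show "q \<in> f' ` pverts G" using f'eq \<open>q \<in> K\<close> by force
    qed
    ultimately show "insert w K \<subseteq> f' ` pverts G" by simp
  qed
  moreover have "f' x = f' y \<or> (f' x, f' y) \<in> parcs H \<inter> K \<times> K \<union> {w} \<times> N \<union> N \<times> {w}"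
    if xy: "(x, y) \<in> parcs G" for x y
  proof -
    have V: "x \<in> pverts G" "y \<in> pverts G" using xy in_arcsD1 in_arcsD2 by auto
    have e1: "f x = f y \<or> (f x, f y) \<in> parcs H" using edge[OF xy] .
    have e2: "f y = f x \<or> (f y, f x) \<in> parcs H" using edge sym[OF xy] by blast
    have toN: "q \<in> N" if "p \<notin> K" "q \<in> K" "(p, q) \<in> parcs H" for p q
      using that arcsH unfolding N_def K_def merged_nbhd_def open_nbhd_def by auto
    show ?thesis
    proof (cases "f x \<in> K")
      case True
      show ?thesis
      proof (cases "f y \<in> K")
        case True
        then show ?thesis using \<open>f x \<in> K\<close> e1 f'eq by auto
      next
        case False
        then have "f x \<in> N" using toN[OF False True] e2 True by auto
        moreover have "f' y = w" using False f'w V by simp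
        ultimately show ?thesis using f'eq True by simp
      qed
    next
      case False
      then have "f' x = w" using f'w V by simp
      show ?thesis
      proof (cases "f y \<in> K")
        case True
        then have "f y \<in> N" using toN[OF False True] e1 False by auto
        then show ?thesis using f'eq True \<open>f' x = w\<close> by simp
      next
        case False
        then have "f' y = w" using f'w V by simp
        then show ?thesis using \<open>f' x = w\<close> by simp
      qed
    qed
  qed
  moreover have "(x, y) \<in> parcs G"
    if V: "x \<in> pverts G" "y \<in> pverts G"
      and a: "(f' x, f' y) \<in> parcs H \<inter> K \<times> K \<union> {w} \<times> N \<union> N \<times> {w}"
      and nr: "(f' x, f' y) \<notin> R \<inter> K \<times> K \<union> {w} \<times> Nr \<union> Nr \<times> {w}" for x y
  proof -
    have wN: "(x', y') \<in> parcs G"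
      if V': "x' \<in> pverts G" "y' \<in> pverts G" and x': "f' x' = w" and y': "f' y' \<in> N" "f' y' \<notin> Nr"
      for x' y'
    proof -
      have "f' y' = f y'" using y'(1) NK f'K f'eq V' by blast
      then have "f y' \<in> black_merged_nbhd u v (H, R)" using y' unfolding Nr_def by simp
      moreover have "f x' = u \<or> f x' = v" using x' f'w inK V' by blast
      ultimately have "(f x', f y') \<in> parcs H - R" unfolding black_merged_nbhd_def by auto
      then show ?thesis using black V' by blast
    qed
    from a consider "(f' x, f' y) \<in> parcs H \<inter> K \<times> K" | "f' x = w" "f' y \<in> N" | "f' x \<in> N" "f' y = w"
      by blast
    then show ?thesis
    proof cases
      case 1
      then have "f' x = f x" "f' y = f y" using f'K f'eq V by blast+
      then show ?thesis using black V 1 nr by auto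
    next
      case 2
      then show ?thesis using wN V nr by blast
    next
      case 3
      then show ?thesis using wN[of y x] V nr sym by blast
    qed
  qed
  ultimately show ?thesis
    unfolding C bag_map_def using NK unfolding Nr_def by auto
qed

section \<open>The first bad bag\<close>

text \<open>The vertex \<open>a\<close> can enter a packing at cost \<open>m\<close>: at most \<open>m\<close> vertices of \<open>G\<close> dominate all
  vertices of \<open>A\<close> that a packing containing \<open>a\<close> has to avoid, together with \<open>a\<close> itself if
  \<open>a \<in> A\<close>. The dominating vertices need not lie in \<open>A\<close>.\<close>

definition cheap_vertex :: "'a pair_pre_digraph \<Rightarrow> nat \<Rightarrow> 'a set \<Rightarrow> 'a \<Rightarrow> bool" where
  "cheap_vertex G m A a \<longleftrightarrow> (\<exists>D \<subseteq> pverts G. card D \<le> m \<and>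
     (\<forall>c \<in> A. closed_nbhd G a \<inter> closed_nbhd G c \<noteq> {} \<longrightarrow> (\<exists>d \<in> D. c \<in> closed_nbhd G d)))"

text \<open>One vertex of \<open>G\<close> dominates all members in \<open>A\<close> of the bag \<open>p\<close>. Nothing is asked of the other
  members of the bag.\<close>

definition good_bag :: "'a pair_pre_digraph \<Rightarrow> 'a set \<Rightarrow> ('a \<Rightarrow> 'a) \<Rightarrow> 'a \<Rightarrow> bool" where
  "good_bag G A f p \<longleftrightarrow> (\<exists>d \<in> pverts G. \<forall>x \<in> A. f x = p \<longrightarrow> x \<in> closed_nbhd G d)"

text \<open>The counting step, for the graph right after the first contraction that produces a bad bag \<open>w\<close>:
  the cheap vertex found is a member of \<open>w\<close>. The vertices \<open>d1\<close> and \<open>d2\<close> dominate the two good bags that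
  were merged into \<open>w\<close>.\<close>

lemma bad_bag_cheap:
  assumes G: "pair_graph G" and k: "k \<ge> 2" and A: "A \<subseteq> pverts G"
    and f: "bag_map G f (H, R)" and deg: "red_degree_le k (H, R)"
    and w: "w \<in> pverts H" and bad: "\<not> good_bag G A f w"
    and two: "d1 \<in> pverts G" "d2 \<in> pverts G"
      "\<And>x. \<lbrakk>x \<in> A; f x = w\<rbrakk> \<Longrightarrow> x \<in> closed_nbhd G d1 \<or> x \<in> closed_nbhd G d2"
    and good: "\<And>p. \<lbrakk>p \<in> pverts H; p \<noteq> w\<rbrakk> \<Longrightarrow> good_bag G A f p"
  shows "\<exists>a \<in> A. cheap_vertex G (4 * k ^ 2) A a"
proof -
  interpret pair_graph G by fact
  note sym = arcs_symmetric
  have im: "f ` pverts G = pverts H" and RH: "R \<subseteq> pverts H \<times> pverts H"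
    and arcsH: "parcs H \<subseteq> pverts H \<times> pverts H"
    and edge: "\<And>x y. (x, y) \<in> parcs G \<Longrightarrow> f x = f y \<or> (f x, f y) \<in> parcs H"
    and black: "\<And>x y. \<lbrakk>x \<in> pverts G; y \<in> pverts G; (f x, f y) \<in> parcs H - R\<rbrakk> \<Longrightarrow> (x, y) \<in> parcs G"
    using f unfolding bag_map_def by auto
  have finH: "finite (pverts H)" using im finite_verts by (metis finite_imageI)
  define red where "red p = {q. (p, q) \<in> R}" for p
  have red_sub: "red p \<subseteq> pverts H" for p using RH unfolding red_def by auto
  have fin_red: "finite (red p)" for p using finite_subset[OF red_sub finH] .
  have card_red: "card (red p) \<le> k" if "p \<in> pverts H" for p
    using deg that unfolding red_degree_le_def red_def by auto
  define h where "h = inv_into (pverts G) f"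
  have h: "h p \<in> pverts G \<and> f (h p) = p" if "p \<in> pverts H" for p
    using that unfolding h_def im[symmetric] by (simp add: inv_into_into f_inv_into_f)
  obtain g where g: "\<And>p. \<lbrakk>p \<in> pverts H; p \<noteq> w\<rbrakk> \<Longrightarrow>
      g p \<in> pverts G \<and> (\<forall>x \<in> A. f x = p \<longrightarrow> x \<in> closed_nbhd G (g p))"
    using good unfolding good_bag_def by metis
  have only_red: "q \<in> red w" if "(w, q) \<in> parcs H" for q
  proof (rule ccontr)
    assume "q \<notin> red w"
    then have bl: "(w, q) \<in> parcs H - R" using that unfolding red_def by simp
    have q: "q \<in> pverts H" using that arcsH by auto
    have "x \<in> closed_nbhd G (h q)" if "x \<in> A" "f x = w" for x
    proof -
      have "(x, h q) \<in> parcs G" using black[of x "h q"] that bl h[OF q] A by auto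
      then show ?thesis using sym unfolding closed_nbhd_def open_nbhd_def by auto
    qed
    then show False using bad h[OF q] unfolding good_bag_def by blast
  qed
  \<comment> \<open>An empty set of members in \<open>A\<close> would make \<open>w\<close> good.\<close>
  obtain a where a: "a \<in> A" "f a = w"
    using bad two(1) unfolding good_bag_def by blast
  \<comment> \<open>\<open>S\<close> consists of the bags reached by one or two red edges from \<open>w\<close>, and may contain \<open>w\<close> itself.\<close>
  define S where "S = red w \<union> (\<Union>p \<in> red w. red p)"
  define D where "D = g ` (S - {w}) \<union> {d1, d2} \<union> h ` red w"
  have finS: "finite S" unfolding S_def using fin_red by auto
  have S_sub: "S \<subseteq> pverts H" unfolding S_def using red_sub by auto
  have "card (\<Union>p \<in> red w. red p) \<le> (\<Sum>p \<in> red w. card (red p))"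
    using card_UN_le[OF fin_red] .
  also have "\<dots> \<le> card (red w) * k"
    using sum_bounded_above[of "red w" "\<lambda>p. card (red p)" k] card_red red_sub by auto
  also have "\<dots> \<le> k * k" using card_red[OF w] by simp
  finally have cS: "card S \<le> k + k * k"
    unfolding S_def using card_Un_le[of "red w" "\<Union>p \<in> red w. red p"] card_red[OF w] by linarith
  have c1: "card (g ` (S - {w})) \<le> k + k * k"
    using card_image_le[of "S - {w}" g] card_mono[of S "S - {w}"] finS cS by fastforce
  have c2: "card {d1, d2} \<le> 2" by (simp add: card_insert_if)
  have c3: "card (h ` red w) \<le> k"
    using card_image_le[OF fin_red, of h w] card_red[OF w] by simp
  have "card D \<le> (k + k * k) + 2 + k"
    unfolding D_def using c1 c2 c3 card_Un_le[of "g ` (S - {w})" "{d1, d2}"]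
      card_Un_le[of "g ` (S - {w}) \<union> {d1, d2}" "h ` red w"] by linarith
  also have "\<dots> \<le> 4 * k ^ 2"
  proof -
    have "2 * k \<le> k * k" using k by simp
    then show ?thesis using k unfolding power2_eq_square by linarith
  qed
  finally have cD: "card D \<le> 4 * k ^ 2" .
  have DG: "D \<subseteq> pverts G"
  proof -
    have "g ` (S - {w}) \<subseteq> pverts G" using g S_sub by blast
    moreover have "h ` red w \<subseteq> pverts G" using h red_sub by blast
    ultimately show ?thesis unfolding D_def using two(1,2) by simp
  qed
  have dom_S: "\<exists>d \<in> D. c \<in> closed_nbhd G d" if "c \<in> A" "f c \<in> insert w S" for c
  proof (cases "f c = w")
    case True
    then show ?thesis using two(3)[OF that(1)] unfolding D_def by auto
  next
    case False
    then have "f c \<in> S - {w}" using that by auto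
    moreover have "c \<in> closed_nbhd G (g (f c))" using g[of "f c"] False calculation S_sub that by auto
    ultimately show ?thesis unfolding D_def by blast
  qed
  have near: "f x = f y \<or> (f x, f y) \<in> parcs H" if "y \<in> closed_nbhd G x" for x y
    using that edge unfolding closed_nbhd_def open_nbhd_def by auto
  have "\<exists>d \<in> D. c \<in> closed_nbhd G d"
    if c: "c \<in> A" and ne: "closed_nbhd G a \<inter> closed_nbhd G c \<noteq> {}" for c
  proof -
    obtain z where z: "z \<in> closed_nbhd G a" "z \<in> closed_nbhd G c" using ne by auto
    have cz: "c \<in> closed_nbhd G z" using z(2) sym unfolding closed_nbhd_def open_nbhd_def by auto
    have "f z = w \<or> f z \<in> red w" using near[OF z(1)] a only_red by auto
    moreover have "f c \<in> insert w S" if "f z = w"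
      using near[OF cz] that only_red unfolding S_def by auto
    moreover have "f c \<in> insert w S \<or> c \<in> closed_nbhd G (h (f z))" if fz: "f z \<in> red w"
    proof -
      have hz: "h (f z) \<in> pverts G" "f (h (f z)) = f z" using h fz red_sub by auto
      consider "f c = f z" | "f c \<in> red (f z)" | "(f z, f c) \<in> parcs H - R"
        using near[OF cz] unfolding red_def by auto
      then show ?thesis
      proof cases
        case 3
        then have "(h (f z), c) \<in> parcs G" using black[of "h (f z)" c] hz c A by auto
        then show ?thesis unfolding closed_nbhd_def open_nbhd_def by simp
      qed (use fz in \<open>auto simp: S_def\<close>)
    qed
    ultimately show ?thesis using dom_S[OF c] unfolding D_def by blast
  qed
  then show ?thesis using a DG cD unfolding cheap_vertex_def by blast
qed

text \<open>Without a cheap vertex, no contraction can produce a bad bag.\<close>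

lemma all_bags_good:
  assumes G: "pair_graph G" and k: "k \<ge> 2" and A: "A \<subseteq> pverts G"
    and steps: "(contraction_step k)\<^sup>*\<^sup>* (G, {}) T"
    and no_cheap: "\<not> (\<exists>a \<in> A. cheap_vertex G (4 * k ^ 2) A a)"
  shows "\<exists>f. bag_map G f T \<and> (\<forall>p \<in> pverts (fst T). good_bag G A f p)"
  using steps
proof (induction rule: rtranclp_induct)
  case base
  have "good_bag G A id p" if "p \<in> pverts G" for p
    using that unfolding good_bag_def closed_nbhd_def by auto
  then show ?case using bag_map_id[OF G] by auto
next
  case (step T T')
  obtain H R where T: "T = (H, R)" by fastforce
  obtain f where f: "bag_map G f (H, R)" and good: "\<And>p. p \<in> pverts H \<Longrightarrow> good_bag G A f p"
    using step.IH T by auto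
  obtain u v w where uv: "u \<in> pverts H" "v \<in> pverts H" and w: "w \<notin> pverts H - {u, v}"
    and T': "T' = contraction u v w (H, R)" and deg: "red_degree_le k T'"
    using step.hyps(2) T unfolding contraction_step_def by auto
  obtain H' R' where T'': "T' = (H', R')" by fastforce
  define f' where "f' = (\<lambda>x. if f x \<in> {u, v} then w else f x)"
  have f': "bag_map G f' (H', R')"
    using bag_map_contraction[OF G f uv w] T' T'' unfolding f'_def by simp
  have H': "pverts H' = insert w (pverts H - {u, v})"
    using T' T'' unfolding contraction_def by (auto simp: Let_def)
  have others: "good_bag G A f' p" if p: "p \<in> pverts H'" "p \<noteq> w" for p
  proof -
    have "f x = p" if "f' x = p" for x
      using that p unfolding f'_def by (auto split: if_splits)
    then show ?thesis using good[of p] p H' unfolding good_bag_def by auto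
  qed
  have "good_bag G A f' w"
  proof (rule ccontr)
    assume bad: "\<not> good_bag G A f' w"
    obtain d1 d2 where d: "d1 \<in> pverts G" "d2 \<in> pverts G"
      "\<And>x. x \<in> A \<Longrightarrow> f x = u \<Longrightarrow> x \<in> closed_nbhd G d1"
      "\<And>x. x \<in> A \<Longrightarrow> f x = v \<Longrightarrow> x \<in> closed_nbhd G d2"
      using good uv unfolding good_bag_def by meson
    have "f x = u \<or> f x = v" if "x \<in> A" "f' x = w" for x
    proof -
      have "f x \<in> pverts H" using that A f unfolding bag_map_def by auto
      then show ?thesis using that w unfolding f'_def by (auto split: if_splits)
    qed
    then have "x \<in> closed_nbhd G d1 \<or> x \<in> closed_nbhd G d2" if "x \<in> A" "f' x = w" for x
      using that d by blast
    then show False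
      using bad_bag_cheap[OF G k A f' _ _ bad d(1,2) _ others] deg T'' H' no_cheap by auto
  qed
  then show ?case using f' others T'' by auto
qed

lemma exists_cheap_vertex:
  assumes G: "pair_graph G" and k: "k \<ge> 2" and tw: "twin_width_le G k"
    and A: "A \<subseteq> pverts G" "A \<noteq> {}"
  shows "\<exists>a \<in> A. cheap_vertex G (4 * k ^ 2) A a"
proof (rule ccontr)
  assume no: "\<not> ?thesis"
  obtain H R where steps: "(contraction_step k)\<^sup>*\<^sup>* (G, {}) (H, R)" and c: "card (pverts H) = 1"
    using tw unfolding twin_width_le_def by auto
  obtain f where f: "bag_map G f (H, R)" and good: "\<forall>p \<in> pverts H. good_bag G A f p"
    using all_bags_good[OF G k A(1) steps no] by auto
  obtain p where p: "pverts H = {p}" using c card_1_singletonE by blast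
  have "f x = p" if "x \<in> A" for x using that A f p unfolding bag_map_def by auto
  then obtain d where d: "d \<in> pverts G" "\<forall>x \<in> A. x \<in> closed_nbhd G d"
    using good p unfolding good_bag_def by auto
  have "card {d} \<le> 4 * k ^ 2" using k by (simp add: Suc_leI)
  then have "cheap_vertex G (4 * k ^ 2) A a" for a
    unfolding cheap_vertex_def using d by (intro exI[of _ "{d}"]) auto
  then show False using no A by blast
qed

section \<open>The greedy argument\<close>

text \<open>The set \<open>A\<close> of vertices still to be dominated shrinks during the recursion, so a cheap vertex is
  required for every nonempty subset \<open>B\<close> of \<open>A\<close>, relative to \<open>B\<close>. The set \<open>D\<close> is not confined to \<open>A\<close>,
  and the neighbourhoods of \<open>P\<close> are disjoint in all of \<open>G\<close>.\<close>

lemma dominating_vs_packing: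
  assumes "finite A" and "A \<subseteq> pverts G"
    and "\<And>B. \<lbrakk>B \<subseteq> A; B \<noteq> {}\<rbrakk> \<Longrightarrow> \<exists>a \<in> B. cheap_vertex G m B a"
  shows "\<exists>D P. D \<subseteq> pverts G \<and> A \<subseteq> (\<Union>d \<in> D. closed_nbhd G d) \<and>
    P \<subseteq> A \<and> disjoint_family_on (closed_nbhd G) P \<and> card D \<le> m * card P"
  using assms
proof (induction A rule: finite_psubset_induct)
  case (psubset A)
  show ?case
  proof (cases "A = {}")
    case True
    then show ?thesis by (intro exI[of _ "{}"]) (auto simp: disjoint_family_on_def)
  next
    case False
    then obtain a where a: "a \<in> A" "cheap_vertex G m A a" using psubset.prems by blast
    then obtain D0 where D0: "D0 \<subseteq> pverts G" "card D0 \<le> m"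
      "\<And>c. \<lbrakk>c \<in> A; closed_nbhd G a \<inter> closed_nbhd G c \<noteq> {}\<rbrakk> \<Longrightarrow> \<exists>d \<in> D0. c \<in> closed_nbhd G d"
      unfolding cheap_vertex_def by blast
    define B where "B = {c \<in> A. closed_nbhd G a \<inter> closed_nbhd G c = {}}"
    have aB: "a \<notin> B" unfolding B_def closed_nbhd_def by auto
    have BA: "B \<subset> A" using aB a unfolding B_def by auto
    have "B \<subseteq> pverts G" using BA psubset.prems(1) by blast
    moreover have "\<exists>a \<in> C. cheap_vertex G m C a" if "C \<subseteq> B" "C \<noteq> {}" for C
      by (rule psubset.prems(2)) (use that BA in auto)
    ultimately have "\<exists>D P. D \<subseteq> pverts G \<and> B \<subseteq> (\<Union>d \<in> D. closed_nbhd G d) \<and>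
        P \<subseteq> B \<and> disjoint_family_on (closed_nbhd G) P \<and> card D \<le> m * card P"
      by (rule psubset.IH[OF BA])
    then obtain D P where DP: "D \<subseteq> pverts G" "B \<subseteq> (\<Union>d \<in> D. closed_nbhd G d)" "P \<subseteq> B"
      "disjoint_family_on (closed_nbhd G) P" "card D \<le> m * card P"
      by blast
    have "finite P" using DP(3) BA psubset.hyps by (meson psubset_imp_subset rev_finite_subset)
    then have cP: "card (insert a P) = Suc (card P)" 
      using card_insert_disjoint[of P a] aB DP(3) by blast
    have "A \<subseteq> (\<Union>d \<in> D0 \<union> D. closed_nbhd G d)"
    proof
      fix c assume c: "c \<in> A"
      show "c \<in> (\<Union>d \<in> D0 \<union> D. closed_nbhd G d)"
      proof (cases "c \<in> B")
        case True
        then show ?thesis using DP(2) by auto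
      next
        case False
        then have "\<exists>d \<in> D0. c \<in> closed_nbhd G d" using D0(3)[OF c] c unfolding B_def by simp
        then show ?thesis by auto
      qed
    qed
    moreover have "insert a P \<subseteq> A" using a DP(3) BA by auto
    moreover have "disjoint_family_on (closed_nbhd G) (insert a P)"
      using DP(3,4) unfolding B_def disjoint_family_on_def by blast
    moreover have "card (D0 \<union> D) \<le> m * card (insert a P)"
      using card_Un_le[of D0 D] D0(2) DP(5) cP by simp
    ultimately show ?thesis using D0(1) DP(1) by (meson Un_least)
  qed
qed

theorem theorem1p11:
  fixes G :: "'a pair_pre_digraph" and k :: nat
  assumes "pair_graph G"
    and "k \<ge> 2"
    and "twin_width_le G k"
  shows "domination_number G \<le> 4 * k ^ 2 * packing_number G"
proof -
  interpret pair_graph G by fact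
  obtain D P where DP: "D \<subseteq> pverts G" "pverts G \<subseteq> (\<Union>d \<in> D. closed_nbhd G d)"
    "P \<subseteq> pverts G" "disjoint_family_on (closed_nbhd G) P" "card D \<le> 4 * k ^ 2 * card P"
    using dominating_vs_packing[OF finite_verts subset_refl, of "4 * k ^ 2"]
      exists_cheap_vertex[OF assms] by blast
  have "finite {D. dominating_set G D}" "finite {P. packing G P}"
    by (rule finite_subset[of _ "Pow (pverts G)"];
        auto simp: dominating_set_def packing_def)+
  moreover have "dominating_set G D" "packing G P"
    using DP unfolding dominating_set_def packing_def by auto
  ultimately have "domination_number G \<le> card D" "card P \<le> packing_number G"
    unfolding domination_number_def packing_number_def by (auto intro: Min_le Max_ge)
  then show ?thesis using DP(5) by (meson le_trans mult_le_mono2)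
qed

end
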